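(* Let $K\ge 1$ be an integer, $N_0>0$, $P>0$, $r^*\ge 0$, and let $h_1,\dots,h_K$ be nonzero complex numbers with $|h_1|\ge |h_2|\ge\dots\ge|h_K|$. Define $$P_{O1}^* = (e^{Kr^*}-1)\frac{N_0}{K}\sum_{i=1}^{K}\frac{1}{|h_i|^2}.$$ If $P_{O1}^*\le P$, then the OMA-TYPE-I optimization problem is feasible, its optimal value $R_{O1}$ satisfies $$R_{O1}\le R_N,$$ where $R_N$ is the optimal value of the NOMA optimization problem with the same data, and equality $R_{O1}=R_N$ holds only when $|h_1|=|h_2|=\dots=|h_K|$.
   Context: Data: $K$ users, channel coefficients $h_i$, noise power $N_0$, total power $P$, minimum rate $r^*$. NOMA optimization problem: $R_N$ is the maximum of $\sum_{i=1}^K r_i$ over $P_1,\dots,P_K\ge0$ subject to $r_i=\ln\Big(1+\frac{P_i|h_i|^2}{N_0+|h_i|^2\sum_{j=1}^{i-1}P_j}\Big)$ for $1\le i\le K$ (empty sum is $0$), $\sum_{i=1}^K P_i\le P$, and $\min_i r_i\ge r^*$. OMA-TYPE-I optimization problem: $R_{O1}$ is the maximum of $\sum_{i=1}^K r_i$ over $P_1,\dots,P_K\ge0$ subject to $r_i=\frac1K\ln\Big(1+\frac{KP_i|h_i|^2}{N_0}\Big)$ for $1\le i\le K$, $\sum_{i=1}^K P_i\le P$, and $\min_i r_i\ge r^*$. *)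

theory Defs
  imports Complex_Main
begin

text \<open>
  Users are indexed by \<open>{1..K}\<close>; the values of \<open>h\<close> and of a power allocation \<open>p\<close>
  outside that range are irrelevant. \<open>N0\<close> is the noise power, \<open>Ptot\<close> the total power
  and \<open>rmin\<close> the minimum rate.
\<close>

definition noma_rate :: "real \<Rightarrow> (nat \<Rightarrow> complex) \<Rightarrow> (nat \<Rightarrow> real) \<Rightarrow> nat \<Rightarrow> real" where
  "noma_rate N0 h p i =
     ln (1 + p i * (cmod (h i))\<^sup>2 / (N0 + (cmod (h i))\<^sup>2 * (\<Sum>j = 1..<i. p j)))"

definition oma1_rate :: "nat \<Rightarrow> real \<Rightarrow> (nat \<Rightarrow> complex) \<Rightarrow> (nat \<Rightarrow> real) \<Rightarrow> nat \<Rightarrow> real" where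
  "oma1_rate K N0 h p i = 1 / real K * ln (1 + real K * p i * (cmod (h i))\<^sup>2 / N0)"

definition feasible_powers ::
    "nat \<Rightarrow> real \<Rightarrow> real \<Rightarrow> ((nat \<Rightarrow> real) \<Rightarrow> nat \<Rightarrow> real) \<Rightarrow> (nat \<Rightarrow> real) set" where
  "feasible_powers K Ptot rmin rate =
     {p. (\<forall>i\<in>{1..K}. 0 \<le> p i) \<and> (\<Sum>i = 1..K. p i) \<le> Ptot \<and> Min (rate p ` {1..K}) \<ge> rmin}"

text \<open>
  The predicate \<open>is_optimal_value\<close> requires the maximal sum rate to be attained, so it also
  entails feasibility, and it determines \<open>R\<close> uniquely.
\<close>

definition is_optimal_value ::
    "nat \<Rightarrow> real \<Rightarrow> real \<Rightarrow> ((nat \<Rightarrow> real) \<Rightarrow> nat \<Rightarrow> real) \<Rightarrow> real \<Rightarrow> bool" where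
  "is_optimal_value K Ptot rmin rate R \<longleftrightarrow>
     (\<exists>p\<in>feasible_powers K Ptot rmin rate. (\<Sum>i = 1..K. rate p i) = R) \<and>
     (\<forall>p\<in>feasible_powers K Ptot rmin rate. (\<Sum>i = 1..K. rate p i) \<le> R)"

lemma is_optimal_value_unique:
  assumes "is_optimal_value K Ptot rmin rate R" and "is_optimal_value K Ptot rmin rate R'"
  shows "R = R'"
  using assms unfolding is_optimal_value_def by (metis order_antisym)

definition oma1_min_power :: "nat \<Rightarrow> real \<Rightarrow> real \<Rightarrow> (nat \<Rightarrow> complex) \<Rightarrow> real" where
  "oma1_min_power K N0 rmin h =
     (exp (real K * rmin) - 1) * (N0 / real K) * (\<Sum>i = 1..K. 1 / (cmod (h i))\<^sup>2)"

end

theory Submission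
  imports Defs "HOL-Analysis.Function_Metric"
begin

text \<open>
  Put \<open>n i = N0 / |h i|\<^sup>2\<close> with \<open>n 0 = 0\<close>, an increasing sequence. To give the users rates
  \<open>r\<close>, OMA spends \<open>(\<Sum>i. n i * (exp (K * r i) - 1)) / K\<close>, and summation by parts writes both
  this and the NOMA power as combinations of the increments \<open>n i - n (i - 1) \<ge> 0\<close>. The
  coefficients are \<open>(\<Sum>j\<ge>i. exp (K * r j) - 1) / K\<close> and \<open>exp (\<Sum>j\<ge>i. r j) - 1\<close>, and the
  former dominate the latter by AM-GM. Hence NOMA attains the rates of an OMA optimum
  within the power budget; if the channels differ there is power left over, because then
  either some AM-GM step is strict or all rates vanish, and giving the surplus to user
  \<open>K\<close>, who interferes with nobody, strictly increases the sum rate.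
\<close>

section \<open>AM-GM through convexity of the exponential\<close>

lemma exp_ge_tangent:
  fixes x s :: real
  shows "exp s * (1 + (x - s)) \<le> exp x"
    and "x \<noteq> s \<Longrightarrow> exp s * (1 + (x - s)) < exp x"
proof -
  have e: "exp x = exp s * exp (x - s)"
    by (simp flip: exp_add)
  show "exp s * (1 + (x - s)) \<le> exp x"
    unfolding e by (rule mult_left_mono) (auto intro: exp_ge_add_one_self)
  assume "x \<noteq> s"
  \<comment> \<open>By the equality case of \<open>ln y \<le> y - 1\<close> with
    \<open>y = exp (x - s)\<close>, the tangent touches the graph only at
    \<open>x = s\<close>.\<close>
  have "exp (x - s) \<noteq> 1 + (x - s)"
    using ln_eq_minus_one[of "exp (x - s)"] \<open>x \<noteq> s\<close> by auto
  with exp_ge_add_one_self[of "x - s"] have "1 + (x - s) < exp (x - s)"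
    by linarith
  then show "exp s * (1 + (x - s)) < exp x"
    unfolding e by simp
qed

text \<open>Taking every tangent at the mean \<open>s\<close> makes the linear terms cancel in the
  sum. Two different values cannot both equal \<open>s\<close>, so at least one tangent inequality
  is then strict.\<close>

lemma sum_exp_ge_exp_mean:
  fixes x :: "'a \<Rightarrow> real"
  assumes "finite A" and "A \<noteq> {}"
  shows "card A * (exp (sum x A / card A) - 1) \<le> (\<Sum>j\<in>A. exp (x j) - 1)"
    and "\<lbrakk>j \<in> A; k \<in> A; x j \<noteq> x k\<rbrakk> \<Longrightarrow>
      card A * (exp (sum x A / card A) - 1) < (\<Sum>j\<in>A. exp (x j) - 1)"
proof -
  define s where "s = sum x A / card A"
  have c: "card A > 0"
    using assms by (simp add: card_gt_0_iff)
  have "(\<Sum>j\<in>A. 1 + (x j - s)) = card A"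
    using c by (simp add: sum.distrib sum_subtractf s_def)
  then have eq: "card A * (exp s - 1) = (\<Sum>j\<in>A. exp s * (1 + (x j - s)) - 1)"
    by (simp add: sum_subtractf right_diff_distrib mult.commute flip: sum_distrib_left)
  show "card A * (exp (sum x A / card A) - 1) \<le> (\<Sum>j\<in>A. exp (x j) - 1)"
    unfolding s_def[symmetric] eq by (rule sum_mono) (simp add: exp_ge_tangent)
  assume jk: "j \<in> A" "k \<in> A" "x j \<noteq> x k"
  then obtain i where "i \<in> A" "x i \<noteq> s"
    by metis
  then show "card A * (exp (sum x A / card A) - 1) < (\<Sum>j\<in>A. exp (x j) - 1)"
    unfolding s_def[symmetric] eq using assms
    by (intro sum_strict_mono_ex1 bexI[of _ i] ballI) (auto simp: exp_ge_tangent)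
qed

text \<open>The AM-GM inequality for \<open>exp (K * r j)\<close>, \<open>j \<ge> i\<close>, padded with \<open>i - 1\<close> ones.\<close>

lemma exp_tail_sum_le:
  fixes r :: "nat \<Rightarrow> real"
  assumes "i \<in> {1..K}"
  shows "exp (\<Sum>j = i..K. r j) - 1 \<le> (\<Sum>j = i..K. exp (real K * r j) - 1) / K"
    and "\<lbrakk>i = 1; j \<in> {1..K}; k \<in> {1..K}; r j \<noteq> r k\<rbrakk> \<Longrightarrow>
      exp (\<Sum>j = i..K. r j) - 1 < (\<Sum>j = i..K. exp (real K * r j) - 1) / K"
    and "\<lbrakk>1 < i; j \<in> {i..K}; r j \<noteq> 0\<rbrakk> \<Longrightarrow>
      exp (\<Sum>j = i..K. r j) - 1 < (\<Sum>j = i..K. exp (real K * r j) - 1) / K"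
proof -
  define x where "x j = (if i \<le> j then real K * r j else 0)" for j
  have K: "K > 0" using assms by auto
  have sub: "{i..K} \<subseteq> {1..K}" using assms by auto
  have "sum x {1..K} = (\<Sum>j = i..K. real K * r j)"
    using assms by (intro sum.mono_neutral_cong_right) (auto simp: x_def)
  \<comment> \<open>The factor \<open>K\<close> in \<open>x\<close> cancels against the number of
    all users, padding included; this is why the tail sum appears undivided in the exponent.\<close>
  then have mean: "sum x {1..K} / card {1..K} = (\<Sum>j = i..K. r j)"
    using K by (simp flip: sum_distrib_left)
  have sum: "(\<Sum>j = 1..K. exp (x j) - 1) = (\<Sum>j = i..K. exp (real K * r j) - 1)"
    using assms by (intro sum.mono_neutral_cong_right) (auto simp: x_def)
  have ne: "finite {1..K}" "{1..K} \<noteq> {}" using K by auto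
  note le = sum_exp_ge_exp_mean[where x = x, OF ne, unfolded mean sum]
  show "exp (\<Sum>j = i..K. r j) - 1 \<le> (\<Sum>j = i..K. exp (real K * r j) - 1) / K"
    using le(1) K by (simp add: field_simps)
  show "exp (\<Sum>j = i..K. r j) - 1 < (\<Sum>j = i..K. exp (real K * r j) - 1) / K"
    if "i = 1" "j \<in> {1..K}" "k \<in> {1..K}" "r j \<noteq> r k"
    using le(2)[of j k] K that by (simp add: x_def field_simps)
  show "exp (\<Sum>j = i..K. r j) - 1 < (\<Sum>j = i..K. exp (real K * r j) - 1) / K"
    if "1 < i" "j \<in> {i..K}" "r j \<noteq> 0"
    \<comment> \<open>Since \<open>1 < i\<close>, index 1 is a padding position:
      \<open>x 1 = 0\<close> differs from \<open>x j = K * r j\<close>.\<close>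
    using le(2)[of j 1] K that by (simp add: x_def field_simps)
qed

section \<open>Transmit powers as combinations of noise increments\<close>

text \<open>
  The total power that successive decoding spends on users \<open>1, \<dots>, k\<close> to give them the
  rates \<open>r\<close>, when user \<open>i\<close> sees normalised noise \<open>n i\<close> (in the application
  \<open>N0 / |h i|\<^sup>2\<close>).
\<close>

primrec noma_power :: "(nat \<Rightarrow> real) \<Rightarrow> (nat \<Rightarrow> real) \<Rightarrow> nat \<Rightarrow> real" where
  "noma_power n r 0 = 0"
| "noma_power n r (Suc k) =
     noma_power n r k * exp (r (Suc k)) + n (Suc k) * (exp (r (Suc k)) - 1)"

lemma sum_increments:
  fixes n :: "nat \<Rightarrow> real"
  assumes "n 0 = 0"
  shows "(\<Sum>i = 1..k. n i - n (i - 1)) = n k"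
  using assms by (induction k) auto

text \<open>Appending a user with \<open>e = exp (r (Suc k))\<close> turns a coefficient
  \<open>y - 1\<close> into \<open>e * y - 1 = e * (y - 1) + (e - 1)\<close>. The extra terms
  \<open>e - 1\<close> are weighted by increments that telescope to \<open>n k\<close>.\<close>

lemma noma_power_eq_sum:
  assumes "n 0 = 0"
  shows "noma_power n r k = (\<Sum>i = 1..k. (n i - n (i - 1)) * (exp (\<Sum>j = i..k. r j) - 1))"
proof (induction k)
  case (Suc k)
  let ?d = "\<lambda>i. n i - n (i - 1)" and ?e = "exp (r (Suc k))"
  have "(\<Sum>i = 1..k. ?d i * (exp (\<Sum>j = i..Suc k. r j) - 1))
      = (\<Sum>i = 1..k. ?e * (?d i * (exp (\<Sum>j = i..k. r j) - 1)) + (?e - 1) * ?d i)"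
    by (intro sum.cong) (auto simp: exp_add algebra_simps)
  also have "\<dots> = ?e * noma_power n r k + (?e - 1) * n k"
    unfolding sum.distrib sum_distrib_left[symmetric] Suc.IH sum_increments[of n, OF assms] ..
  finally show ?case
    by (simp add: algebra_simps)
qed simp

text \<open>Abel summation, bringing the OMA power to the same increments as
  \<open>noma_power_eq_sum\<close>, so that only coefficients remain to be compared.\<close>

lemma sum_by_parts_tail:
  fixes n a :: "nat \<Rightarrow> real"
  assumes "n 0 = 0"
  shows "(\<Sum>j = 1..k. n j * a j) = (\<Sum>i = 1..k. (n i - n (i - 1)) * (\<Sum>j = i..k. a j))"
proof (induction k)
  case (Suc k)
  let ?d = "\<lambda>i. n i - n (i - 1)"
  have "(\<Sum>i = 1..k. ?d i * (\<Sum>j = i..Suc k. a j))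
      = (\<Sum>i = 1..k. ?d i * (\<Sum>j = i..k. a j) + a (Suc k) * ?d i)"
    by (intro sum.cong) (auto simp: algebra_simps)
  also have "\<dots> = (\<Sum>j = 1..k. n j * a j) + a (Suc k) * n k"
    unfolding sum.distrib sum_distrib_left[symmetric] Suc.IH sum_increments[of n, OF assms] ..
  finally show ?case
    by (simp add: algebra_simps)
qed simp

text \<open>With nonnegative increments as weights, \<open>exp_tail_sum_le\<close> applies term by
  term. Strictness needs one index with a positive weight and a strict AM-GM step.\<close>

lemma noma_power_le_oma_power:
  fixes n r :: "nat \<Rightarrow> real"
  assumes "n 0 = 0" and "K \<ge> 1" and "0 < n 1"
    and mono: "\<And>i. i \<in> {1..K} \<Longrightarrow> n (i - 1) \<le> n i"
  shows "noma_power n r K \<le> (\<Sum>j = 1..K. n j * (exp (real K * r j) - 1)) / K"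
    and "\<lbrakk>a \<in> {1<..K}; n (a - 1) < n a; b \<in> {1..K}; r b \<noteq> 0\<rbrakk> \<Longrightarrow>
      noma_power n r K < (\<Sum>j = 1..K. n j * (exp (real K * r j) - 1)) / K"
proof -
  let ?d = "\<lambda>i. n i - n (i - 1)"
  let ?l = "\<lambda>i. exp (\<Sum>j = i..K. r j) - 1"
  let ?u = "\<lambda>i. (\<Sum>j = i..K. exp (real K * r j) - 1) / K"
  have u: "(\<Sum>j = 1..K. n j * (exp (real K * r j) - 1)) / K = (\<Sum>i = 1..K. ?d i * ?u i)"
    unfolding sum_by_parts_tail[of n, OF assms(1)]
    by (simp only: sum_divide_distrib[of _ "{1..K}"] times_divide_eq_right)
  have le: "?d i * ?l i \<le> ?d i * ?u i" if "i \<in> {1..K}" for i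
    using mono[OF that] exp_tail_sum_le(1)[OF that, of r] by (intro mult_left_mono) auto
  show "noma_power n r K \<le> (\<Sum>j = 1..K. n j * (exp (real K * r j) - 1)) / K"
    unfolding u noma_power_eq_sum[of n, OF assms(1)] by (intro sum_mono le)
  assume a: "a \<in> {1<..K}" "n (a - 1) < n a" and b: "b \<in> {1..K}" "r b \<noteq> 0"
  have "\<exists>i\<in>{1..K}. ?d i * ?l i < ?d i * ?u i"
  \<comment> \<open>If \<open>r a = r b\<close>, then \<open>r a\<close> is nonzero and the padded
    inequality is strict at \<open>a\<close>. Otherwise the rates are not all equal, and index 1
    works, its weight being \<open>n 1 - n 0 = n 1 > 0\<close>.\<close>
  proof (cases "r a = r b")
    case True
    then show ?thesis
      using a b exp_tail_sum_le(3)[of a K a r]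
      by (intro bexI[of _ a] mult_strict_left_mono) auto
  next
    case False
    then show ?thesis
      using a b assms(1-3) exp_tail_sum_le(2)[of 1 K a b r]
      by (intro bexI[of _ 1] mult_strict_left_mono) auto
  qed
  then show "noma_power n r K < (\<Sum>j = 1..K. n j * (exp (real K * r j) - 1)) / K"
    unfolding u noma_power_eq_sum[of n, OF assms(1)]
    by (intro sum_strict_mono_ex1) (use le in auto)
qed

lemma noma_power_nonneg:
  assumes "\<And>i. i \<in> {1..k} \<Longrightarrow> 0 \<le> n i" and "\<And>i. i \<in> {1..k} \<Longrightarrow> 0 \<le> r i"
  shows "0 \<le> noma_power n r k"
  using assms by (induction k) auto

lemma noma_power_zero_rates:
  assumes "\<And>i. i \<in> {1..k} \<Longrightarrow> r i = 0"
  shows "noma_power n r k = 0"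
  using assms by (induction k) auto

section \<open>Existence of optimal values and feasibility of OMA\<close>

lemma feasible_powers_iff:
  assumes "K \<ge> 1"
  shows "p \<in> feasible_powers K Ptot rmin rate \<longleftrightarrow>
    (\<forall>i\<in>{1..K}. 0 \<le> p i) \<and> (\<Sum>i = 1..K. p i) \<le> Ptot \<and> (\<forall>i\<in>{1..K}. rmin \<le> rate p i)"
  using assms by (auto simp: feasible_powers_def)

text \<open>
  Powers of the users outside \<open>{1..K}\<close> are reset to \<open>0\<close>, so that the search for a
  maximiser takes place in a compact box.
\<close>

lemma ex_optimal_value:
  assumes K: "K \<ge> 1"
    and ne: "feasible_powers K Ptot rmin rate \<noteq> {}"
    and local: "\<And>p q i. \<lbrakk>i \<in> {1..K}; \<And>j. j \<in> {1..K} \<Longrightarrow> p j = q j\<rbrakk> \<Longrightarrow> rate p i = rate q i"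
    and cont: "\<And>i. i \<in> {1..K} \<Longrightarrow> continuous_on {p. \<forall>j. 0 \<le> p j} (\<lambda>p. rate p i)"
  shows "\<exists>R. is_optimal_value K Ptot rmin rate R"
proof -
  define F where "F = feasible_powers K Ptot rmin rate"
  define C where "C = PiE UNIV (\<lambda>i. if i \<in> {1..K} then {0..Ptot} else {0})"
  define restr where "restr p i = (if i \<in> {1..K} then p i else 0)" for p :: "nat \<Rightarrow> real" and i
  have C_nonneg: "C \<subseteq> {p. \<forall>j. 0 \<le> p j}"
    by (force simp: C_def PiE_iff split: if_splits)
  \<comment> \<open>Tychonoff's theorem; \<open>euclidean_product_topology\<close> identifies the
    product topology with the topology of the function type.\<close>
  have C: "compact C"
    using compactin_PiE[of "\<lambda>_. euclidean" UNIV "\<lambda>i. if i \<in> {1..K} then {0..Ptot} else {0}"]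
    by (simp add: C_def euclidean_product_topology)
  have contC: "continuous_on C (\<lambda>p. rate p i)" if "i \<in> {1..K}" for i
    using cont[OF that] C_nonneg by (rule continuous_on_subset)
  have rate_restr: "rate (restr p) i = rate p i" if "i \<in> {1..K}" for p i
    by (rule local[OF that]) (simp add: restr_def)
  have F_restr: "restr p \<in> F" if "p \<in> F" for p
    using that K by (auto simp: F_def feasible_powers_iff rate_restr) (auto simp: restr_def)
  have C_restr: "restr p \<in> C" if "p \<in> F" for p
  proof -
    have "p i \<le> Ptot" if "i \<in> {1..K}" for i
      using \<open>p \<in> F\<close> K that member_le_sum[of i "{1..K}" p]
      by (auto simp: F_def feasible_powers_iff)
    with that K show ?thesis
      by (auto simp: C_def restr_def F_def feasible_powers_iff)
  qed
  have "closed C"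
    using C by (rule compact_imp_closed)
  have "C \<inter> F = {p \<in> C. (\<Sum>i = 1..K. p i) \<le> Ptot} \<inter> (\<Inter>i\<in>{1..K}. {p \<in> C. rmin \<le> rate p i})"
    using K C_nonneg by (auto simp: F_def feasible_powers_iff)
  moreover have "closed {p \<in> C. (\<Sum>i = 1..K. p i) \<le> Ptot}"
    using \<open>closed C\<close>
    by (intro continuous_on_closed_Collect_le continuous_intros)
      (auto intro: continuous_on_subset[OF continuous_on_product_coordinates])
  moreover have "closed (\<Inter>i\<in>{1..K}. {p \<in> C. rmin \<le> rate p i})"
    using \<open>closed C\<close> contC
    by (intro closed_INT ballI continuous_on_closed_Collect_le continuous_intros) auto
  ultimately have "closed (C \<inter> F)" by auto
  with C have "compact (C \<inter> F)"
    using compact_Int_closed[of C "C \<inter> F"] by simp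
  moreover have "C \<inter> F \<noteq> {}"
    using ne C_restr F_restr by (auto simp: F_def)
  moreover have "continuous_on (C \<inter> F) (\<lambda>p. \<Sum>i = 1..K. rate p i)"
    by (intro continuous_on_sum continuous_on_subset[OF contC]) auto
  ultimately obtain p where p: "p \<in> C \<inter> F"
    and max: "\<And>q. q \<in> C \<inter> F \<Longrightarrow> (\<Sum>i = 1..K. rate q i) \<le> (\<Sum>i = 1..K. rate p i)"
    using continuous_attains_sup[of "C \<inter> F" "\<lambda>p. \<Sum>i = 1..K. rate p i"] by blast
  have "(\<Sum>i = 1..K. rate q i) \<le> (\<Sum>i = 1..K. rate p i)" if "q \<in> F" for q
    using max[of "restr q"] C_restr[OF that] F_restr[OF that] by (simp add: rate_restr)
  with p show ?thesis
    by (auto simp: is_optimal_value_def F_def)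
qed

lemma continuous_on_oma1_rate:
  assumes "N0 > 0"
  shows "continuous_on {p. \<forall>j. 0 \<le> p j} (\<lambda>p. oma1_rate K N0 h p i)"
proof -
  have "1 + real K * p i * (cmod (h i))\<^sup>2 / N0 > 0" if "\<forall>j. 0 \<le> p j" for p
    using assms that by (intro add_pos_nonneg) auto
  then have "\<forall>p\<in>{p. \<forall>j. 0 \<le> p j}. 1 + real K * p i * (cmod (h i))\<^sup>2 / N0 \<noteq> 0"
    by (metis less_irrefl mem_Collect_eq)
  then show ?thesis
    unfolding oma1_rate_def using assms
    by (intro continuous_intros continuous_on_subset[OF continuous_on_product_coordinates]) auto
qed

lemma continuous_on_noma_rate:
  assumes "N0 > 0"
  shows "continuous_on {p. \<forall>j. 0 \<le> p j} (\<lambda>p. noma_rate N0 h p i)"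
proof -
  have d: "N0 + (cmod (h i))\<^sup>2 * (\<Sum>j = 1..<i. p j) > 0" if "\<forall>j. 0 \<le> p j" for p
    using assms that by (intro add_pos_nonneg mult_nonneg_nonneg sum_nonneg) auto
  have "1 + p i * (cmod (h i))\<^sup>2 / (N0 + (cmod (h i))\<^sup>2 * (\<Sum>j = 1..<i. p j)) > 0"
    if "\<forall>j. 0 \<le> p j" for p
    using d[OF that] that by (intro add_pos_nonneg) auto
  then have l: "\<forall>p\<in>{p. \<forall>j. 0 \<le> p j}.
      1 + p i * (cmod (h i))\<^sup>2 / (N0 + (cmod (h i))\<^sup>2 * (\<Sum>j = 1..<i. p j)) \<noteq> 0"
    by (metis less_irrefl mem_Collect_eq)
  have "\<forall>p\<in>{p. \<forall>j. 0 \<le> p j}. N0 + (cmod (h i))\<^sup>2 * (\<Sum>j = 1..<i. p j) \<noteq> 0"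
    using d by (metis less_irrefl mem_Collect_eq)
  with l show ?thesis
    unfolding noma_rate_def
    by (intro continuous_intros continuous_on_subset[OF continuous_on_product_coordinates]) auto
qed

lemma oma1_feasible:
  assumes "K \<ge> 1" and "N0 > 0" and "rmin \<ge> 0" and "\<forall>i\<in>{1..K}. h i \<noteq> 0"
    and "oma1_min_power K N0 rmin h \<le> Ptot"
  shows "feasible_powers K Ptot rmin (oma1_rate K N0 h) \<noteq> {}"
proof -
  \<comment> \<open>The powers that give every user exactly the rate \<open>rmin\<close>; their
    total is \<open>oma1_min_power\<close>.\<close>
  define q where "q i = (exp (real K * rmin) - 1) * (N0 / real K) * (1 / (cmod (h i))\<^sup>2)" for i
  have "oma1_rate K N0 h q i = rmin" if "i \<in> {1..K}" for i
    using assms that by (simp add: oma1_rate_def q_def)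
  moreover have "sum q {1..K} \<le> Ptot"
    using assms(5) by (simp add: q_def oma1_min_power_def sum_distrib_left)
  moreover have "0 \<le> q i" for i
    using assms by (simp add: q_def)
  ultimately have "q \<in> feasible_powers K Ptot rmin (oma1_rate K N0 h)"
    using assms(1) by (simp add: feasible_powers_iff)
  then show ?thesis by blast
qed

section \<open>Turning an OMA allocation into a NOMA allocation\<close>

text \<open>In terms of cumulative powers \<open>T\<close> the interference telescopes, so a rate
  depends on two consecutive values of \<open>T\<close> only.\<close>

lemma noma_rate_increments:
  assumes "N0 > 0" and "h (Suc k) \<noteq> 0" and "T 0 = 0" and "T k \<ge> 0"
  shows "noma_rate N0 h (\<lambda>i. T i - T (i - 1)) (Suc k) =
    ln ((T (Suc k) + N0 / (cmod (h (Suc k)))\<^sup>2) / (T k + N0 / (cmod (h (Suc k)))\<^sup>2))"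
proof -
  let ?g = "(cmod (h (Suc k)))\<^sup>2"
  have g: "?g > 0" using assms by simp
  have "N0 + ?g * T k > 0" using assms g by (simp add: add_pos_nonneg)
  moreover have "T k + N0 / ?g > 0" using assms g by (simp add: add_nonneg_pos)
  ultimately have "1 + (T (Suc k) - T k) * ?g / (N0 + ?g * T k)
      = (T (Suc k) + N0 / ?g) / (T k + N0 / ?g)"
    using g by (simp add: divide_simps) (simp add: algebra_simps)
  moreover have "(\<Sum>j = 1..<Suc k. T j - T (j - 1)) = T k"
    unfolding atLeastLessThanSuc_atLeastAtMost by (rule sum_increments) fact
  ultimately show ?thesis
    by (simp add: noma_rate_def del: sum.op_ivl_Suc)
qed

text \<open>Users below \<open>K\<close> keep their OMA rates at NOMA cost, and user
  \<open>K\<close> receives the rest of the budget, so the whole of \<open>Ptot\<close> is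
  spent.\<close>

lemma noma_dominates_oma1:
  assumes K: "K \<ge> 1" and N0: "N0 > 0" and P: "Ptot > 0" and rmin: "rmin \<ge> 0"
    and h: "\<forall>i\<in>{1..K}. h i \<noteq> 0"
    and anti: "\<forall>i\<in>{1..K}. \<forall>j\<in>{1..K}. i \<le> j \<longrightarrow> cmod (h i) \<ge> cmod (h j)"
    and q: "q \<in> feasible_powers K Ptot rmin (oma1_rate K N0 h)"
  obtains p where "p \<in> feasible_powers K Ptot rmin (noma_rate N0 h)"
    and "(\<Sum>i = 1..K. oma1_rate K N0 h q i) \<le> (\<Sum>i = 1..K. noma_rate N0 h p i)"
    and "\<not> (\<forall>i\<in>{1..K}. \<forall>j\<in>{1..K}. cmod (h i) = cmod (h j)) \<Longrightarrow>
      (\<Sum>i = 1..K. oma1_rate K N0 h q i) < (\<Sum>i = 1..K. noma_rate N0 h p i)"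
proof -
  define n where "n i = (if i = 0 then 0 else N0 / (cmod (h i))\<^sup>2)" for i
  define r where "r = oma1_rate K N0 h q"
  \<comment> \<open>Cumulative powers; only the last value is raised to \<open>Ptot\<close>, which
    leaves the interference seen by every user unchanged.\<close>
  define T where "T = (noma_power n r)(K := Ptot)"
  define p where "p i = T i - T (i - 1)" for i
  have n0: "n 0 = 0" by (simp add: n_def)
  have npos: "n i > 0" if "i \<in> {1..K}" for i
    using that h N0 by (auto simp: n_def)
  have nmono: "n (i - 1) \<le> n i" if "i \<in> {1..K}" for i
  proof (cases "i = 1")
    case True
    then show ?thesis using npos[OF that] n0 by simp
  next
    case False
    then have i: "i - 1 \<in> {1..K}" using that by auto
    then have "cmod (h (i - 1)) \<ge> cmod (h i)" "h i \<noteq> 0" "h (i - 1) \<noteq> 0"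
      using that anti h by auto
    then show ?thesis
      using False that N0 by (auto simp: n_def intro!: divide_left_mono power_mono mult_pos_pos)
  qed
  have qsum: "sum q {1..K} \<le> Ptot" and qnn: "\<And>i. i \<in> {1..K} \<Longrightarrow> 0 \<le> q i"
    and rge: "\<And>i. i \<in> {1..K} \<Longrightarrow> rmin \<le> r i"
    using q K by (auto simp: feasible_powers_iff r_def)
  have rnn: "0 \<le> r i" if "i \<in> {1..K}" for i
    using rge[OF that] rmin by simp
  \<comment> \<open>Inverting the OMA rate formula recovers the power from the rate.\<close>
  have "n i * (exp (real K * r i) - 1) = K * q i" if i: "i \<in> {1..K}" for i
  proof -
    have "1 + real K * q i * (cmod (h i))\<^sup>2 / N0 > 0"
      using N0 qnn[OF i] by (intro add_pos_nonneg) auto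
    then have "exp (real K * r i) = 1 + real K * q i * (cmod (h i))\<^sup>2 / N0"
      using K by (simp add: r_def oma1_rate_def)
    then show ?thesis using i h N0 by (auto simp: n_def)
  qed
  then have oma: "(\<Sum>j = 1..K. n j * (exp (real K * r j) - 1)) / K = sum q {1..K}"
    using K by (simp flip: sum_distrib_left)
  have "noma_power n r K \<le> sum q {1..K}"
    using noma_power_le_oma_power(1)[of n K r] n0 K npos[of 1] nmono oma by simp
  with qsum have le: "noma_power n r K \<le> Ptot" by simp
  have S: "0 \<le> noma_power n r k" if "k \<le> K" for k
    using that npos rnn by (intro noma_power_nonneg) (auto intro: less_imp_le)
  have less: "noma_power n r K < Ptot"
    if "\<not> (\<forall>i\<in>{1..K}. \<forall>j\<in>{1..K}. cmod (h i) = cmod (h j))"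
  proof (cases "\<forall>i\<in>{1..K}. r i = 0")
    case True
    then have "noma_power n r K = 0" by (intro noma_power_zero_rates) blast
    then show ?thesis using P by simp
  next
    case False
    then obtain b where b: "b \<in> {1..K}" "r b \<noteq> 0" by blast
    \<comment> \<open>If \<open>n\<close> never increased strictly after index 1, all channel gains
      would equal the first one.\<close>
    have "\<exists>a\<in>{1<..K}. n (a - 1) < n a"
    proof (rule ccontr)
      assume neg: "\<not> ?thesis"
      have eq: "cmod (h k) = cmod (h 1)" if "1 \<le> k" "k \<le> K" for k
        using that
      proof (induction k rule: dec_induct)
        case (step k)
        then have k: "Suc k \<in> {1<..K}" by auto
        with neg have "\<not> n (Suc k - 1) < n (Suc k)" by blast
        then have "n (Suc k) = n k"
          using nmono[of "Suc k"] k by simp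
        then have "(cmod (h (Suc k)))\<^sup>2 = (cmod (h k))\<^sup>2"
          using step N0 h by (simp add: n_def field_simps)
        then show ?case using step by simp
      qed simp
      have "cmod (h i) = cmod (h j)" if "i \<in> {1..K}" "j \<in> {1..K}" for i j
        using eq[of i] eq[of j] that by simp
      with that show False by blast
    qed
    then obtain a where "a \<in> {1<..K}" "n (a - 1) < n a" by blast
    then show ?thesis
      using noma_power_le_oma_power(2)[of n K a b r] b n0 K npos[of 1] nmono oma qsum by simp
  qed
  have T0: "T 0 = 0" using K by (simp add: T_def)
  \<comment> \<open>This is the recursion of \<open>noma_power\<close>, with equality for
    \<open>Suc k < K\<close>; at \<open>Suc k = K\<close> it is the budget bound
    \<open>le\<close>.\<close>
  have Tge: "T k * exp (r (Suc k)) + n (Suc k) * (exp (r (Suc k)) - 1) \<le> T (Suc k)"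
    if "Suc k \<le> K" for k
    using that le by (auto simp: T_def)
  have Tnn: "0 \<le> T k" if "k \<le> K" for k
    using that S P by (simp add: T_def)
  have ratio: "exp (r (Suc k)) \<le> (T (Suc k) + n (Suc k)) / (T k + n (Suc k))"
    and Tstep: "T k \<le> T (Suc k)"
    and rate: "noma_rate N0 h p (Suc k) = ln ((T (Suc k) + n (Suc k)) / (T k + n (Suc k)))"
    and pos: "T k + n (Suc k) > 0"
    if k: "Suc k \<le> K" for k
  proof -
    show pos: "T k + n (Suc k) > 0"
      using Tnn[of k] npos[of "Suc k"] k by simp
    show "exp (r (Suc k)) \<le> (T (Suc k) + n (Suc k)) / (T k + n (Suc k))"
      using Tge[OF k] pos by (simp add: field_simps)
    \<comment> \<open>Nonnegative rates force \<open>T\<close> to be nondecreasing, that is, the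
      powers \<open>p\<close> to be nonnegative.\<close>
    have "(T k + n (Suc k)) * 1 \<le> (T k + n (Suc k)) * exp (r (Suc k))"
      using pos rnn[of "Suc k"] k by (intro mult_left_mono) auto
    then show "T k \<le> T (Suc k)"
      using Tge[OF k] by (simp add: algebra_simps)
    show "noma_rate N0 h p (Suc k) = ln ((T (Suc k) + n (Suc k)) / (T k + n (Suc k)))"
      unfolding p_def[abs_def] using noma_rate_increments[of N0 h k T] N0 h k T0 Tnn[of k]
      by (simp add: n_def)
  qed
  have dom: "r i \<le> noma_rate N0 h p i" if i: "i \<in> {1..K}" for i
  proof -
    obtain k where k: "i = Suc k" "Suc k \<le> K" using i by (cases i) auto
    then show ?thesis
      using ratio[OF k(2)] rate[OF k(2)] by (simp add: ln_ge_iff less_le_trans[OF exp_gt_zero])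
  qed
  have "0 \<le> p i" if "i \<in> {1..K}" for i
    using that Tstep[of "i - 1"] by (simp add: p_def)
  moreover have "sum p {1..K} = Ptot"
    unfolding p_def using sum_increments[of T K] T0 by (simp add: T_def)
  ultimately have "p \<in> feasible_powers K Ptot rmin (noma_rate N0 h)"
    using K order_trans[OF rge dom] by (simp add: feasible_powers_iff)
  moreover have "sum r {1..K} \<le> (\<Sum>i = 1..K. noma_rate N0 h p i)"
    by (intro sum_mono dom)
  moreover have "sum r {1..K} < (\<Sum>i = 1..K. noma_rate N0 h p i)"
    if "\<not> (\<forall>i\<in>{1..K}. \<forall>j\<in>{1..K}. cmod (h i) = cmod (h j))"
  proof (rule sum_strict_mono_ex1)
    obtain k where k: "K = Suc k" using K by (cases K) auto
    \<comment> \<open>The surplus enlarges the numerator \<open>T K + n K\<close> but not the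
      denominator, because \<open>T k\<close> is untouched for \<open>k = K - 1\<close>.\<close>
    have "noma_power n r (Suc k) < T (Suc k)" "T k = noma_power n r k"
      using less[OF that] by (simp_all add: T_def k)
    then have "exp (r K) < (T K + n K) / (T k + n K)"
      using pos[of k] by (simp add: k field_simps)
    moreover have "noma_rate N0 h p K = ln ((T K + n K) / (T k + n K))"
      using rate[of k] by (simp add: k)
    ultimately have "r K < noma_rate N0 h p K"
      by (metis exp_gt_zero exp_less_cancel_iff exp_ln less_trans)
    with K show "\<exists>i\<in>{1..K}. r i < noma_rate N0 h p i" by auto
  qed (use dom in auto)
  ultimately show thesis
    using that unfolding r_def by blast
qed

theorem theorem2:
  fixes K :: nat and N0 Ptot rmin :: real and h :: "nat \<Rightarrow> complex"
  assumes "K \<ge> 1" and "N0 > 0" and "Ptot > 0" and "rmin \<ge> 0"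
    and "\<forall>i\<in>{1..K}. h i \<noteq> 0"
    and "\<forall>i\<in>{1..K}. \<forall>j\<in>{1..K}. i \<le> j \<longrightarrow> cmod (h i) \<ge> cmod (h j)"
    and "oma1_min_power K N0 rmin h \<le> Ptot"
  shows "feasible_powers K Ptot rmin (oma1_rate K N0 h) \<noteq> {} \<and>
    (\<exists>R_O1 R_N. is_optimal_value K Ptot rmin (oma1_rate K N0 h) R_O1 \<and>
       is_optimal_value K Ptot rmin (noma_rate N0 h) R_N \<and>
       R_O1 \<le> R_N \<and>
       (R_O1 = R_N \<longrightarrow> (\<forall>i\<in>{1..K}. \<forall>j\<in>{1..K}. cmod (h i) = cmod (h j))))"
proof (intro conjI)
  show ne: "feasible_powers K Ptot rmin (oma1_rate K N0 h) \<noteq> {}"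
    using assms by (intro oma1_feasible)
  then have "\<exists>R. is_optimal_value K Ptot rmin (oma1_rate K N0 h) R"
    using assms(1,2) by (intro ex_optimal_value continuous_on_oma1_rate) (auto simp: oma1_rate_def)
  then obtain R_O1 where O1: "is_optimal_value K Ptot rmin (oma1_rate K N0 h) R_O1" ..
  then obtain q where q: "q \<in> feasible_powers K Ptot rmin (oma1_rate K N0 h)"
    and R_O1: "R_O1 = (\<Sum>i = 1..K. oma1_rate K N0 h q i)"
    by (auto simp: is_optimal_value_def)
  obtain p where p: "p \<in> feasible_powers K Ptot rmin (noma_rate N0 h)"
    and le: "R_O1 \<le> (\<Sum>i = 1..K. noma_rate N0 h p i)"
    and less: "\<not> (\<forall>i\<in>{1..K}. \<forall>j\<in>{1..K}. cmod (h i) = cmod (h j)) \<Longrightarrow>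
      R_O1 < (\<Sum>i = 1..K. noma_rate N0 h p i)"
    using noma_dominates_oma1[OF assms(1-6) q] unfolding R_O1 by blast
  have local: "noma_rate N0 h p i = noma_rate N0 h p' i"
    if "i \<in> {1..K}" "\<And>j. j \<in> {1..K} \<Longrightarrow> p j = p' j" for p p' i
  proof -
    have "sum p {1..<i} = sum p' {1..<i}"
      using that by (intro sum.cong) auto
    with that show ?thesis by (simp add: noma_rate_def)
  qed
  \<comment> \<open>The allocation \<open>p\<close> built from the OMA optimum also shows that the
    NOMA problem is feasible.\<close>
  have "\<exists>R. is_optimal_value K Ptot rmin (noma_rate N0 h) R"
    using assms(1,2) p by (intro ex_optimal_value local continuous_on_noma_rate) blast+
  then obtain R_N where N: "is_optimal_value K Ptot rmin (noma_rate N0 h) R_N" ..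
  then have "(\<Sum>i = 1..K. noma_rate N0 h p i) \<le> R_N"
    using p by (auto simp: is_optimal_value_def)
  with O1 N le less show "\<exists>R_O1 R_N. is_optimal_value K Ptot rmin (oma1_rate K N0 h) R_O1 \<and>
       is_optimal_value K Ptot rmin (noma_rate N0 h) R_N \<and>
       R_O1 \<le> R_N \<and>
       (R_O1 = R_N \<longrightarrow> (\<forall>i\<in>{1..K}. \<forall>j\<in>{1..K}. cmod (h i) = cmod (h j)))"
    by (intro exI[of _ R_O1] exI[of _ R_N]) fastforce
qed

end
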